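(* Every $\mathrm{GL}$-rack is isomorphic, as a $\mathrm{GL}$-rack, to a $\mathrm{GL}$-rack of the form $\left(\sqcup_{i\in I}G/H_i,\ \{z_i\}_{i\in I},\ \{r_i\}_{i\in I},\ \{s_i\}_{i\in I}\right)$.
   Context: A rack $(X,* )$ is a set with a binary operation such that for all $x,y\in X$ there is a unique $z$ with $z*y=x$, and $(x*y)*z=(x*z)*(y*z)$ for all $x,y,z$. A $\mathrm{GL}$-rack is a quadruple $(X,*,\mathtt{u},\mathtt{d})$ with $(X,* )$ a rack and maps $\mathtt{u},\mathtt{d}:X\to X$ such that for all $x,y\in X$: $\mathtt{u}\mathtt{d}(x*x)=x=\mathtt{d}\mathtt{u}(x*x)$; $\mathtt{u}(x*y)=\mathtt{u}(x)*y$; $\mathtt{d}(x*y)=\mathtt{d}(x)*y$; $x*\mathtt{u}(y)=x*y$; $x*\mathtt{d}(y)=x*y$. A $\mathrm{GL}$-rack homomorphism is a map preserving $*$ and commuting with the $\mathtt{u}$'s and with the $\mathtt{d}$'s. The $\mathrm{GL}$-racks $\left(\sqcup_{i\in I}G/H_i,\{z_i\},\{r_i\},\{s_i\}\right)$ are constructed as follows. Data: a group $G$, an index set $I$, families $\{z_i\}_{i\in I}$, $\{r_i\}_{i\in I}$, $\{s_i\}_{i\in I}$ of elements of $G$, subgroups $H_i\le G$ with $H_i\le C_G(z_i)$ (the centraliser of $z_i$) for all $i\in I$, and a bijection $\tau:I\to I$ with inverse $\mu:I\to I$, such that for all $i\in I$: (1) $r_i^{-1}h r_i\in H_{\tau(i)}$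 for all $h\in H_i$; (2) $s_i^{-1}h s_i\in H_{\mu(i)}$ for all $h\in H_i$; (3) $z_ir_is_{\tau(i)}\in H_i$; (4) $z_is_ir_{\mu(i)}\in H_i$; (5) $z_ir_i=r_iz_{\tau(i)}$; (6) $z_is_i=s_iz_{\mu(i)}$. The underlying set is the disjoint union $\sqcup_{i\in I}G/H_i$ of left cosets, the rack operation is $xH_i*yH_j=yz_jy^{-1}xH_i$, and the Legendrian structure is $\mathtt{u}_r(xH_j)=xr_jH_{\tau(j)}$, $\mathtt{d}_s(xH_j)=xs_jH_{\mu(j)}$. *)

theory Defs
  imports "HOL-Algebra.Coset" "HOL-Algebra.Left_Coset"
begin

section \<open>Racks and GL-racks\<close>

record 'a rack = "'a partial_object" +
  rack_op :: "'a \<Rightarrow> 'a \<Rightarrow> 'a"  (infixl \<open>\<rhd>\<index>\<close> 70)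

record 'a gl_rack = "'a rack" +
  gl_u :: "'a \<Rightarrow> 'a"
  gl_d :: "'a \<Rightarrow> 'a"

locale rack =
  fixes X (structure)
  assumes op_closed: "\<lbrakk>x \<in> carrier X; y \<in> carrier X\<rbrakk> \<Longrightarrow> x \<rhd> y \<in> carrier X"
    and op_ex1: "\<lbrakk>x \<in> carrier X; y \<in> carrier X\<rbrakk> \<Longrightarrow> \<exists>!z. z \<in> carrier X \<and> z \<rhd> y = x"
    and op_distrib:
      "\<lbrakk>x \<in> carrier X; y \<in> carrier X; z \<in> carrier X\<rbrakk>
        \<Longrightarrow> (x \<rhd> y) \<rhd> z = (x \<rhd> z) \<rhd> (y \<rhd> z)"

locale gl_rack = rack X for X (structure) +
  assumes u_closed: "x \<in> carrier X \<Longrightarrow> gl_u X x \<in> carrier X"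
    and d_closed: "x \<in> carrier X \<Longrightarrow> gl_d X x \<in> carrier X"
    and u_d: "x \<in> carrier X \<Longrightarrow> gl_u X (gl_d X (x \<rhd> x)) = x"
    and d_u: "x \<in> carrier X \<Longrightarrow> gl_d X (gl_u X (x \<rhd> x)) = x"
    and u_op: "\<lbrakk>x \<in> carrier X; y \<in> carrier X\<rbrakk> \<Longrightarrow> gl_u X (x \<rhd> y) = gl_u X x \<rhd> y"
    and d_op: "\<lbrakk>x \<in> carrier X; y \<in> carrier X\<rbrakk> \<Longrightarrow> gl_d X (x \<rhd> y) = gl_d X x \<rhd> y"
    and op_u: "\<lbrakk>x \<in> carrier X; y \<in> carrier X\<rbrakk> \<Longrightarrow> x \<rhd> gl_u X y = x \<rhd> y"
    and op_d: "\<lbrakk>x \<in> carrier X; y \<in> carrier X\<rbrakk> \<Longrightarrow> x \<rhd> gl_d X y = x \<rhd> y"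

definition gl_hom ::
  "('a, 'm) gl_rack_scheme \<Rightarrow> ('b, 'n) gl_rack_scheme \<Rightarrow> ('a \<Rightarrow> 'b) set" where
  "gl_hom X Y = {f \<in> carrier X \<rightarrow> carrier Y.
     (\<forall>x \<in> carrier X. \<forall>y \<in> carrier X. f (x \<rhd>\<^bsub>X\<^esub> y) = f x \<rhd>\<^bsub>Y\<^esub> f y) \<and>
     (\<forall>x \<in> carrier X. f (gl_u X x) = gl_u Y (f x)) \<and>
     (\<forall>x \<in> carrier X. f (gl_d X x) = gl_d Y (f x))}"

definition gl_iso ::
  "('a, 'm) gl_rack_scheme \<Rightarrow> ('b, 'n) gl_rack_scheme \<Rightarrow> ('a \<Rightarrow> 'b) set" where
  "gl_iso X Y = {f \<in> gl_hom X Y. bij_betw f (carrier X) (carrier Y)}"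

definition gl_isomorphic ::
  "('a, 'm) gl_rack_scheme \<Rightarrow> ('b, 'n) gl_rack_scheme \<Rightarrow> bool" where
  "gl_isomorphic X Y \<longleftrightarrow> gl_iso X Y \<noteq> {}"


section \<open>The GL-racks on disjoint unions of left cosets\<close>

definition centraliser :: "('g, 'm) monoid_scheme \<Rightarrow> 'g \<Rightarrow> 'g set" where
  "centraliser G z = {g \<in> carrier G. g \<otimes>\<^bsub>G\<^esub> z = z \<otimes>\<^bsub>G\<^esub> g}"

text \<open>
  The inverse \<open>\<mu>\<close> of the bijection \<open>\<tau>\<close> of \<open>I\<close> is \<open>inv_into I \<tau>\<close>.
\<close>

locale gl_coset_data = group G for G (structure) +
  fixes I :: "'i set" and H :: "'i \<Rightarrow> 'a set" and z r s :: "'i \<Rightarrow> 'a" and \<tau> :: "'i \<Rightarrow> 'i"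
  assumes z_closed: "i \<in> I \<Longrightarrow> z i \<in> carrier G"
    and r_closed: "i \<in> I \<Longrightarrow> r i \<in> carrier G"
    and s_closed: "i \<in> I \<Longrightarrow> s i \<in> carrier G"
    and H_subgroup: "i \<in> I \<Longrightarrow> subgroup (H i) G"
    and H_centraliser: "i \<in> I \<Longrightarrow> H i \<subseteq> centraliser G (z i)"
    and \<tau>_bij: "bij_betw \<tau> I I"
    and r_conj: "\<lbrakk>i \<in> I; h \<in> H i\<rbrakk> \<Longrightarrow> inv (r i) \<otimes> h \<otimes> r i \<in> H (\<tau> i)"
    and s_conj: "\<lbrakk>i \<in> I; h \<in> H i\<rbrakk> \<Longrightarrow> inv (s i) \<otimes> h \<otimes> s i \<in> H (inv_into I \<tau> i)"
    and zrs: "i \<in> I \<Longrightarrow> z i \<otimes> r i \<otimes> s (\<tau> i) \<in> H i"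
    and zsr: "i \<in> I \<Longrightarrow> z i \<otimes> s i \<otimes> r (inv_into I \<tau> i) \<in> H i"
    and zr: "i \<in> I \<Longrightarrow> z i \<otimes> r i = r i \<otimes> z (\<tau> i)"
    and zs: "i \<in> I \<Longrightarrow> z i \<otimes> s i = s i \<otimes> z (inv_into I \<tau> i)"

text \<open>
  The point \<open>xH\<^sub>i\<close> of the disjoint union is the pair of \<open>i\<close> and \<open>x <# H i\<close>.
  The operations, defined on representatives, are written as unions over all representatives,
  which avoids a choice; for \<open>gl_coset_data\<close> all members of the union coincide, so it is the
  single coset given by any representative (the lemmas \<open>coset_gl_rack_op\<close>,
  \<open>coset_gl_rack_u\<close> and \<open>coset_gl_rack_d\<close> below).
\<close>

definition coset_gl_rack ::
  "('g, 'm) monoid_scheme \<Rightarrow> 'i set \<Rightarrow> ('i \<Rightarrow> 'g set) \<Rightarrow> ('i \<Rightarrow> 'g) \<Rightarrow> ('i \<Rightarrow> 'g) \<Rightarrow> ('i \<Rightarrow> 'g)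
    \<Rightarrow> ('i \<Rightarrow> 'i) \<Rightarrow> ('i \<times> 'g set) gl_rack" where
  "coset_gl_rack G I H z r s \<tau> =
    \<lparr>carrier = (SIGMA i:I. lcosets\<^bsub>G\<^esub> (H i)),
     rack_op = (\<lambda>(i, A) (j, B).
       (i, \<Union>x\<in>A. \<Union>y\<in>B. (y \<otimes>\<^bsub>G\<^esub> z j \<otimes>\<^bsub>G\<^esub> inv\<^bsub>G\<^esub> y \<otimes>\<^bsub>G\<^esub> x) <#\<^bsub>G\<^esub> H i)),
     gl_u = (\<lambda>(j, A). (\<tau> j, \<Union>x\<in>A. (x \<otimes>\<^bsub>G\<^esub> r j) <#\<^bsub>G\<^esub> H (\<tau> j))),
     gl_d = (\<lambda>(j, A). (inv_into I \<tau> j, \<Union>x\<in>A. (x \<otimes>\<^bsub>G\<^esub> s j) <#\<^bsub>G\<^esub> H (inv_into I \<tau> j)))\<rparr>"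

context gl_coset_data
begin

lemma lcos_eqI:
  assumes "i \<in> I" "x \<in> carrier G" "h \<in> H i"
  shows "(x \<otimes> h) <# H i = x <# H i"
proof -
  have "x \<otimes> h \<in> x <# H i" using assms(3) by (auto simp: l_coset_def)
  then show ?thesis
    using l_repr_independence[OF _ assms(2) H_subgroup[OF assms(1)]] by simp
qed

lemma in_lcos:
  assumes "i \<in> I" "x \<in> carrier G"
  shows "a \<in> x <# H i \<longleftrightarrow> (\<exists>h\<in>H i. a = x \<otimes> h)" "x \<in> x <# H i"
  using lcos_self[OF assms(2) H_subgroup[OF assms(1)]] by (auto simp: l_coset_def)

lemma H_carrier: "i \<in> I \<Longrightarrow> h \<in> H i \<Longrightarrow> h \<in> carrier G"
  by (meson H_subgroup subgroup.mem_carrier)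

lemma coset_gl_rack_op:
  assumes i: "i \<in> I" and j: "j \<in> I" and x: "x \<in> carrier G" and y: "y \<in> carrier G"
  shows "(i, x <# H i) \<rhd>\<^bsub>coset_gl_rack G I H z r s \<tau>\<^esub> (j, y <# H j)
    = (i, (y \<otimes> z j \<otimes> inv y \<otimes> x) <# H i)"
proof -
  have "(b \<otimes> z j \<otimes> inv b \<otimes> a) <# H i = (y \<otimes> z j \<otimes> inv y \<otimes> x) <# H i"
    if a: "a \<in> x <# H i" and b: "b \<in> y <# H j" for a b
  proof -
    obtain h k where h: "h \<in> H i" "a = x \<otimes> h" and k: "k \<in> H j" "b = y \<otimes> k"
      using a[unfolded in_lcos(1)[OF i x]] b[unfolded in_lcos(1)[OF j y]] by blast
    have hc: "h \<in> carrier G" and kc: "k \<in> carrier G" using H_carrier h k i j by auto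
    have zc: "z j \<in> carrier G" using z_closed j by simp
    have kz: "k \<otimes> z j = z j \<otimes> k"
      using H_centraliser[OF j] k(1) by (auto simp: centraliser_def)
    have "b \<otimes> z j \<otimes> inv b = y \<otimes> (k \<otimes> z j) \<otimes> inv k \<otimes> inv y"
      using k kc zc y by (simp add: inv_mult_group m_assoc)
    also have "\<dots> = y \<otimes> z j \<otimes> (k \<otimes> inv k) \<otimes> inv y"
      unfolding kz using kc zc y by (simp add: m_assoc del: r_inv)
    also have "\<dots> = y \<otimes> z j \<otimes> inv y"
      using kc zc y by simp
    finally have "b \<otimes> z j \<otimes> inv b \<otimes> a = (y \<otimes> z j \<otimes> inv y \<otimes> x) \<otimes> h"
      using h hc x y zc by (simp add: m_assoc)
    then show ?thesis using lcos_eqI[OF i _ h(1)] x y zc by simp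
  qed
  then have "(\<Union>a\<in>x <# H i. \<Union>b\<in>y <# H j. (b \<otimes> z j \<otimes> inv b \<otimes> a) <# H i)
      = (\<Union>a\<in>x <# H i. \<Union>b\<in>y <# H j. (y \<otimes> z j \<otimes> inv y \<otimes> x) <# H i)"
    by (intro SUP_cong refl)
  also have "\<dots> = (y \<otimes> z j \<otimes> inv y \<otimes> x) <# H i"
    using in_lcos(2)[OF i x] in_lcos(2)[OF j y] by blast
  finally show ?thesis
    by (simp only: coset_gl_rack_def rack.simps gl_rack.simps prod.case)
qed

lemma push_lcos:
  assumes i: "i \<in> I" and k: "k \<in> I" and x: "x \<in> carrier G" and t: "t \<in> carrier G"
    and conj: "\<And>h. h \<in> H i \<Longrightarrow> inv t \<otimes> h \<otimes> t \<in> H k"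
  shows "(\<Union>a\<in>x <# H i. (a \<otimes> t) <# H k) = (x \<otimes> t) <# H k"
proof -
  have "(a \<otimes> t) <# H k = (x \<otimes> t) <# H k" if a: "a \<in> x <# H i" for a
  proof -
    obtain h where h: "h \<in> H i" "a = x \<otimes> h" using a[unfolded in_lcos(1)[OF i x]] by blast
    have hc: "h \<in> carrier G" using H_carrier h i by auto
    have "t \<otimes> (inv t \<otimes> (h \<otimes> t)) = h \<otimes> t"
      using hc t by (simp add: m_assoc[symmetric])
    then have "a \<otimes> t = (x \<otimes> t) \<otimes> (inv t \<otimes> h \<otimes> t)"
      using h x t hc by (simp add: m_assoc)
    then show ?thesis using lcos_eqI[OF k _ conj[OF h(1)]] x t by simp
  qed
  then have "(\<Union>a\<in>x <# H i. (a \<otimes> t) <# H k) = (\<Union>a\<in>x <# H i. (x \<otimes> t) <# H k)"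
    by (intro SUP_cong refl)
  also have "\<dots> = (x \<otimes> t) <# H k" using in_lcos(2)[OF i x] by blast
  finally show ?thesis .
qed

lemma \<tau>_closed: "i \<in> I \<Longrightarrow> \<tau> i \<in> I"
  using \<tau>_bij by (auto simp: bij_betw_def)

lemma \<mu>_closed: "i \<in> I \<Longrightarrow> inv_into I \<tau> i \<in> I"
  using \<tau>_bij by (metis bij_betw_def inv_into_into)

lemma coset_gl_rack_u:
  assumes "j \<in> I" "x \<in> carrier G"
  shows "gl_u (coset_gl_rack G I H z r s \<tau>) (j, x <# H j) = (\<tau> j, (x \<otimes> r j) <# H (\<tau> j))"
  using push_lcos[of j "\<tau> j" x "r j"] assms r_conj r_closed \<tau>_closed
  by (simp add: coset_gl_rack_def)

lemma coset_gl_rack_d: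
  assumes "j \<in> I" "x \<in> carrier G"
  shows "gl_d (coset_gl_rack G I H z r s \<tau>) (j, x <# H j)
    = (inv_into I \<tau> j, (x \<otimes> s j) <# H (inv_into I \<tau> j))"
  using push_lcos[of j "inv_into I \<tau> j" x "s j"] assms s_conj s_closed \<mu>_closed
  by (simp add: coset_gl_rack_def)

end

end

theory Submission
  imports Defs "HOL-Algebra.Group_Action"
begin

text \<open>
  Let \<open>G\<close> be the group of all GL-rack automorphisms of \<open>X\<close>. It contains the right translations
  \<open>z\<^sub>y: x \<mapsto> x * y\<close>, and \<open>g z\<^sub>y g\<^sup>-\<^sup>1 = z\<^bsub>g y\<^esub>\<close>. Choose a set \<open>I\<close> of representatives of the
  \<open>G\<close>-orbits, let \<open>H\<^sub>i\<close> be the stabiliser of \<open>i\<close>, and identify \<open>gH\<^sub>i\<close> with the point \<open>g i\<close>.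
  As \<open>u\<close> and \<open>d\<close> commute with \<open>G\<close>, they permute the orbits, inversely to each other because
  \<open>u d (x * x) = x\<close> and \<open>x * x\<close> lies in the orbit of \<open>x\<close>. Writing \<open>u i = r\<^sub>i (\<tau> i)\<close> and
  \<open>d i = s\<^sub>i (\<mu> i)\<close> turns \<open>u (g i)\<close> into \<open>(g r\<^sub>i) (\<tau> i)\<close> and \<open>d (g i)\<close> into \<open>(g s\<^sub>i) (\<mu> i)\<close>.
\<close>

section \<open>Homomorphisms and transport of structure\<close>

lemma gl_homD:
  assumes "f \<in> gl_hom X Y"
  shows "x \<in> carrier X \<Longrightarrow> f x \<in> carrier Y"
    and "\<lbrakk>x \<in> carrier X; y \<in> carrier X\<rbrakk> \<Longrightarrow> f (x \<rhd>\<^bsub>X\<^esub> y) = f x \<rhd>\<^bsub>Y\<^esub> f y"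
    and "x \<in> carrier X \<Longrightarrow> f (gl_u X x) = gl_u Y (f x)"
    and "x \<in> carrier X \<Longrightarrow> f (gl_d X x) = gl_d Y (f x)"
  using assms by (auto simp: gl_hom_def)

text \<open>Every point of \<open>Y\<close> is some \<open>f a\<close>, and \<open>f\<close> carries
  the operations of \<open>X\<close> to those of \<open>Y\<close>, so each axiom is pulled back to
  \<open>X\<close>. This spares a verification of the axioms on cosets.\<close>

lemma gl_rack_iso:
  assumes "gl_rack X" and f: "f \<in> gl_iso X Y"
  shows "gl_rack Y"
proof -
  interpret X: gl_rack X by fact
  have hom: "f \<in> gl_hom X Y" and bij: "bij_betw f (carrier X) (carrier Y)"
    using f by (auto simp: gl_iso_def)
  note f_simps = gl_homD(2-4)[OF hom, symmetric]
  note X_closed = X.op_closed X.u_closed X.d_closed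
  have surj: "\<exists>x\<in>carrier X. y = f x" if "y \<in> carrier Y" for y
    using bij that by (auto simp: bij_betw_def)
  have inj: "f x = f y \<longleftrightarrow> x = y" if "x \<in> carrier X" "y \<in> carrier X" for x y
    using bij that by (auto simp: bij_betw_def inj_on_def)
  show ?thesis
  proof
    fix x y assume "x \<in> carrier Y" "y \<in> carrier Y"
    then obtain a b where ab: "a \<in> carrier X" "b \<in> carrier X" "x = f a" "y = f b"
      using surj by metis
    obtain c where c: "c \<in> carrier X" "c \<rhd>\<^bsub>X\<^esub> b = a"
      and uniq: "\<And>c'. \<lbrakk>c' \<in> carrier X; c' \<rhd>\<^bsub>X\<^esub> b = a\<rbrakk> \<Longrightarrow> c' = c"
      using X.op_ex1[OF ab(1,2)] by metis
    show "\<exists>!z. z \<in> carrier Y \<and> z \<rhd>\<^bsub>Y\<^esub> y = x"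
    proof (intro ex1I conjI)
      show "f c \<in> carrier Y" "f c \<rhd>\<^bsub>Y\<^esub> y = x"
        using ab c gl_homD(1)[OF hom] by (auto simp: f_simps)
    next
      fix w assume w: "w \<in> carrier Y \<and> w \<rhd>\<^bsub>Y\<^esub> y = x"
      then obtain c' where c': "c' \<in> carrier X" "w = f c'" using surj by blast
      then have "f (c' \<rhd>\<^bsub>X\<^esub> b) = f a" using w ab by (simp add: f_simps)
      then show "w = f c" using c' ab uniq X_closed by (simp add: inj)
    qed
  next
    fix x y w assume "x \<in> carrier Y" "y \<in> carrier Y" "w \<in> carrier Y"
    then show "(x \<rhd>\<^bsub>Y\<^esub> y) \<rhd>\<^bsub>Y\<^esub> w = (x \<rhd>\<^bsub>Y\<^esub> w) \<rhd>\<^bsub>Y\<^esub> (y \<rhd>\<^bsub>Y\<^esub> w)"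
      by (auto dest!: surj simp: f_simps X_closed) (simp flip: X.op_distrib)
  next
    fix x assume "x \<in> carrier Y"
    then show "gl_u Y x \<in> carrier Y" "gl_d Y x \<in> carrier Y"
      "gl_u Y (gl_d Y (x \<rhd>\<^bsub>Y\<^esub> x)) = x" "gl_d Y (gl_u Y (x \<rhd>\<^bsub>Y\<^esub> x)) = x"
      by (auto dest!: surj simp: f_simps X_closed X.u_d X.d_u gl_homD(1)[OF hom])
  qed (auto dest!: surj simp: f_simps X_closed X.u_op X.d_op X.op_u X.op_d gl_homD(1)[OF hom])
qed

section \<open>The automorphism group and its action\<close>

definition gl_auto :: "('a, 'm) gl_rack_scheme \<Rightarrow> ('a \<Rightarrow> 'a) set" where
  "gl_auto X = gl_hom X X \<inter> Bij (carrier X)"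

definition gl_AutoGroup :: "('a, 'm) gl_rack_scheme \<Rightarrow> ('a \<Rightarrow> 'a) monoid" where
  "gl_AutoGroup X = BijGroup (carrier X)\<lparr>carrier := gl_auto X\<rparr>"

context gl_rack
begin

lemma subgroup_gl_auto: "subgroup (gl_auto X) (BijGroup (carrier X))"
proof (rule subgroup.intro)
  show "gl_auto X \<subseteq> carrier (BijGroup (carrier X))"
    by (auto simp: gl_auto_def BijGroup_def)
next
  fix g h assume g: "g \<in> gl_auto X" and h: "h \<in> gl_auto X"
  then have "compose (carrier X) g h \<in> gl_hom X X"
    by (auto simp: gl_auto_def gl_hom_def compose_eq op_closed u_closed d_closed Pi_iff)
  then show "g \<otimes>\<^bsub>BijGroup (carrier X)\<^esub> h \<in> gl_auto X"
    using g h by (auto simp: gl_auto_def BijGroup_def compose_Bij)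
next
  show "\<one>\<^bsub>BijGroup (carrier X)\<^esub> \<in> gl_auto X"
    by (auto simp: gl_auto_def gl_hom_def BijGroup_def id_Bij op_closed u_closed d_closed)
next
  fix g assume g: "g \<in> gl_auto X"
  then have hom: "g \<in> gl_hom X X" and Bij: "g \<in> Bij (carrier X)"
    by (auto simp: gl_auto_def)
  let ?k = "inv_into (carrier X) g"
  have k: "?k x \<in> carrier X" "g (?k x) = x" if "x \<in> carrier X" for x
    using that Bij by (auto simp: Bij_def bij_betw_def inv_into_into f_inv_into_f)
  \<comment> \<open>An equation for the inverse is checked after applying \<open>g\<close>, which
    reduces each homomorphism law of the inverse to that of \<open>g\<close>.\<close>
  have kI: "?k x = y" if "y \<in> carrier X" "g y = x" for x y
    using that Bij by (auto simp: Bij_def bij_betw_def)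
  have "restrict ?k (carrier X) \<in> gl_hom X X"
    by (auto simp: gl_hom_def k op_closed u_closed d_closed gl_homD[OF hom] intro!: kI)
  then show "inv\<^bsub>BijGroup (carrier X)\<^esub> g \<in> gl_auto X"
    using Bij by (simp del: restrict_apply add: inv_BijGroup gl_auto_def restrict_inv_into_Bij)
qed

abbreviation A where "A \<equiv> gl_AutoGroup X"

sublocale A: group A
  by (simp add: gl_AutoGroup_def subgroup.subgroup_is_group subgroup_gl_auto group_BijGroup)

sublocale A: group_action A "carrier X" "\<lambda>g. g"
proof -
  have "(\<lambda>g. g) \<in> hom A (BijGroup (carrier X))"
    by (auto simp: hom_def gl_AutoGroup_def gl_auto_def BijGroup_def)
  then show "group_action A (carrier X) (\<lambda>g. g)"
    by (simp add: group_action_def group_hom_def group_hom_axioms_def group_BijGroup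
        A.group_axioms)
qed

lemma carrier_A: "carrier A = gl_auto X"
  by (simp add: gl_AutoGroup_def)

lemma A_hom: "g \<in> carrier A \<Longrightarrow> g \<in> gl_hom X X"
  by (simp add: carrier_A gl_auto_def)

lemmas A_homD = gl_homD[OF A_hom]

lemma A_inv:
  assumes "g \<in> carrier A" "x \<in> carrier X"
  shows "(inv\<^bsub>A\<^esub> g) (g x) = x" "g ((inv\<^bsub>A\<^esub> g) x) = x"
  using A.orbit_sym_aux[OF assms refl] A.orbit_sym_aux[of "inv\<^bsub>A\<^esub> g" x, OF _ assms(2) refl] assms(1)
  by auto

lemma A_inv_eqI: "\<lbrakk>g \<in> carrier A; x \<in> carrier X; g x = y\<rbrakk> \<Longrightarrow> (inv\<^bsub>A\<^esub> g) y = x"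
  using A_inv(1) by blast

text \<open>Members of \<open>Bij\<close> are extensional, so their values off the carrier are
  fixed.\<close>

lemma A_eqI:
  assumes "g \<in> carrier A" "h \<in> carrier A" "\<And>x. x \<in> carrier X \<Longrightarrow> g x = h x"
  shows "g = h"
  using assms by (intro extensionalityI[of _ "carrier X"]) (auto simp: carrier_A gl_auto_def Bij_def)

text \<open>Two automorphisms \<open>f\<close> and \<open>g\<close> agree at \<open>x\<close>
  exactly when \<open>g\<close> inverse times \<open>f\<close> fixes \<open>x\<close>. A coset of a
  stabiliser thus amounts to a point of the orbit.\<close>

lemma l_coset_stabilizer:
  assumes "g \<in> carrier A" "x \<in> carrier X"
  shows "g <#\<^bsub>A\<^esub> stabilizer A (\<lambda>g. g) x = {f \<in> carrier A. f x = g x}"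
proof (intro equalityI subsetI)
  fix f assume f: "f \<in> {f \<in> carrier A. f x = g x}"
  then have "inv\<^bsub>A\<^esub> g \<otimes>\<^bsub>A\<^esub> f \<in> stabilizer A (\<lambda>g. g) x"
    using assms by (simp add: stabilizer_def A.composition_rule A_inv(1))
  moreover have "f = g \<otimes>\<^bsub>A\<^esub> (inv\<^bsub>A\<^esub> g \<otimes>\<^bsub>A\<^esub> f)"
    using f assms by (simp flip: A.m_assoc)
  ultimately show "f \<in> g <#\<^bsub>A\<^esub> stabilizer A (\<lambda>g. g) x"
    unfolding l_coset_def by blast
qed (use assms in \<open>auto simp: l_coset_def stabilizer_def A.composition_rule\<close>)

section \<open>Right translations\<close>

definition translation :: "'a \<Rightarrow> 'a \<Rightarrow> 'a" where
  "translation y = (\<lambda>x\<in>carrier X. x \<rhd> y)"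

lemma translation_apply [simp]: "x \<in> carrier X \<Longrightarrow> translation y x = x \<rhd> y"
  by (simp add: translation_def)

text \<open>Unique solvability gives bijectivity, self-distributivity gives compatibility with the
  rack operation, and \<open>u_op\<close> and \<open>d_op\<close> give commutation with
  \<open>u\<close> and \<open>d\<close>.\<close>

lemma translation_in_A:
  assumes y: "y \<in> carrier X"
  shows "translation y \<in> carrier A"
proof -
  have "bij_betw (translation y) (carrier X) (carrier X)"
    unfolding bij_betw_def inj_on_def
  proof (intro conjI ballI impI equalityI subsetI)
    fix a b assume "a \<in> carrier X" "b \<in> carrier X" "translation y a = translation y b"
    \<comment> \<open>Both \<open>a\<close> and \<open>b\<close> solve
      \<open>w \<rhd> y = b \<rhd> y\<close> for \<open>w\<close>.\<close>
    then show "a = b" using op_ex1[of "b \<rhd> y" y] y op_closed by auto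
  next
    fix x assume "x \<in> carrier X"
    then obtain w where "w \<in> carrier X" "w \<rhd> y = x" using op_ex1 y by blast
    then show "x \<in> translation y ` carrier X" by (auto intro!: image_eqI[of _ _ w])
  qed (use y op_closed in auto)
  moreover have "translation y \<in> gl_hom X X"
    using y by (auto simp: gl_hom_def op_closed u_closed d_closed op_distrib[of _ _ y] u_op d_op)
  ultimately show ?thesis
    by (auto simp: carrier_A gl_auto_def Bij_def translation_def)
qed

section \<open>Orbit representatives\<close>

definition orbit_rep :: "'a \<Rightarrow> 'a" where
  "orbit_rep x = (SOME y. y \<in> orbit A (\<lambda>g. g) x)"

lemma orbit_rep_in_orbit: "x \<in> carrier X \<Longrightarrow> orbit_rep x \<in> orbit A (\<lambda>g. g) x"
  unfolding orbit_rep_def by (rule someI) (rule A.orbit_refl)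

lemma orbit_rep_closed: "x \<in> carrier X \<Longrightarrow> orbit_rep x \<in> carrier X"
  using orbit_rep_in_orbit A_homD(1) by (fastforce simp: orbit_def)

text \<open>Orbits that meet are equal, and the choice depends only on the orbit as a set.\<close>

lemma orbit_rep_A:
  assumes "g \<in> carrier A" "x \<in> carrier X"
  shows "orbit_rep (g x) = orbit_rep x"
proof -
  have gx: "g x \<in> carrier X" "g x \<in> orbit A (\<lambda>g. g) x"
    using assms A_homD(1) by (auto simp: orbit_def)
  then have "orbit A (\<lambda>g. g) (g x) = orbit A (\<lambda>g. g) x"
    using assms(2) A.disjoint_union[of "orbit A (\<lambda>g. g) (g x)" "orbit A (\<lambda>g. g) x"] A.orbit_refl[OF gx(1)]
    by (auto simp: orbits_def)
  then show ?thesis by (simp add: orbit_rep_def)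
qed

definition from_rep :: "'a \<Rightarrow> 'a \<Rightarrow> 'a" where
  "from_rep x = (SOME g. g \<in> carrier A \<and> g (orbit_rep x) = x)"

lemma from_rep:
  assumes "x \<in> carrier X"
  shows "from_rep x \<in> carrier A" "from_rep x (orbit_rep x) = x"
proof -
  have "x \<in> orbit A (\<lambda>g. g) (orbit_rep x)"
    using assms A.orbit_sym orbit_rep_closed orbit_rep_in_orbit by blast
  then have "\<exists>g. g \<in> carrier A \<and> g (orbit_rep x) = x"
    by (auto simp: orbit_def)
  from someI_ex[OF this] show "from_rep x \<in> carrier A" "from_rep x (orbit_rep x) = x"
    by (simp_all add: from_rep_def)
qed

lemma orbit_rep_idem: "x \<in> carrier X \<Longrightarrow> orbit_rep (orbit_rep x) = orbit_rep x"
  using orbit_rep_A[OF from_rep(1) orbit_rep_closed, of x x] from_rep(2)[of x] by simp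

definition reps :: "'a set" where
  "reps = orbit_rep ` carrier X"

lemma repsD: "i \<in> reps \<Longrightarrow> i \<in> carrier X" "i \<in> reps \<Longrightarrow> orbit_rep i = i"
  by (auto simp: reps_def orbit_rep_closed orbit_rep_idem)

section \<open>The action of \<open>u\<close> and \<open>d\<close> on orbits\<close>

lemma u_d_op: "x \<in> carrier X \<Longrightarrow> gl_u X (gl_d X x) \<rhd> x = x"
  using u_d[of x] by (simp add: u_op d_op d_closed)

lemma d_u_op: "x \<in> carrier X \<Longrightarrow> gl_d X (gl_u X x) \<rhd> x = x"
  using d_u[of x] by (simp add: u_op d_op u_closed)

text \<open>The automorphism \<open>from_rep x\<close> commutes with \<open>u\<close>, so it moves
  \<open>u\<close> of the representative to \<open>u\<close> of \<open>x\<close>.\<close>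

lemma orbit_rep_u: "x \<in> carrier X \<Longrightarrow> orbit_rep (gl_u X (orbit_rep x)) = orbit_rep (gl_u X x)"
  using orbit_rep_A[OF from_rep(1) u_closed[OF orbit_rep_closed], of x x]
    A_homD(3)[OF from_rep(1) orbit_rep_closed, of x x]
  by (simp add: from_rep(2))

lemma orbit_rep_d: "x \<in> carrier X \<Longrightarrow> orbit_rep (gl_d X (orbit_rep x)) = orbit_rep (gl_d X x)"
  using orbit_rep_A[OF from_rep(1) d_closed[OF orbit_rep_closed], of x x]
    A_homD(4)[OF from_rep(1) orbit_rep_closed, of x x]
  by (simp add: from_rep(2))

text \<open>Translation by \<open>x\<close> carries \<open>u (d x)\<close> to
  \<open>x\<close>.\<close>

lemma orbit_rep_u_d: "x \<in> carrier X \<Longrightarrow> orbit_rep (gl_u X (gl_d X x)) = orbit_rep x"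
  using orbit_rep_A[OF translation_in_A, of x "gl_u X (gl_d X x)"] u_d_op[of x]
  by (simp add: u_closed d_closed)

lemma orbit_rep_d_u: "x \<in> carrier X \<Longrightarrow> orbit_rep (gl_d X (gl_u X x)) = orbit_rep x"
  using orbit_rep_A[OF translation_in_A, of x "gl_d X (gl_u X x)"] d_u_op[of x]
  by (simp add: u_closed d_closed)

definition rep_u :: "'a \<Rightarrow> 'a" where "rep_u i = orbit_rep (gl_u X i)"
definition rep_d :: "'a \<Rightarrow> 'a" where "rep_d i = orbit_rep (gl_d X i)"

lemma rep_u_d_closed: "i \<in> reps \<Longrightarrow> rep_u i \<in> reps" "i \<in> reps \<Longrightarrow> rep_d i \<in> reps"
  by (auto simp: rep_u_def rep_d_def reps_def u_closed d_closed orbit_rep_closed)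

lemma rep_d_rep_u: "i \<in> reps \<Longrightarrow> rep_d (rep_u i) = i"
  by (simp add: rep_u_def rep_d_def repsD orbit_rep_d orbit_rep_d_u u_closed)

lemma rep_u_rep_d: "i \<in> reps \<Longrightarrow> rep_u (rep_d i) = i"
  by (simp add: rep_u_def rep_d_def repsD orbit_rep_u orbit_rep_u_d d_closed)

lemma bij_rep_u: "bij_betw rep_u reps reps"
  by (rule bij_betwI[of _ _ _ rep_d]) (auto simp: rep_u_d_closed rep_d_rep_u rep_u_rep_d)

text \<open>Replaces the abstract inverse \<mu> in the coset data by the explicit map
  \<open>rep_d\<close>.\<close>

lemma inv_into_rep_u: "i \<in> reps \<Longrightarrow> inv_into reps rep_u i = rep_d i"
  using bij_rep_u by (intro inv_into_f_eq) (auto simp: bij_betw_def rep_u_d_closed rep_u_rep_d)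

section \<open>The coset data\<close>

abbreviation Stab where "Stab \<equiv> stabilizer A (\<lambda>g. g)"
abbreviation r where "r i \<equiv> from_rep (gl_u X i)"
abbreviation s where "s i \<equiv> from_rep (gl_d X i)"

lemma r_s_closed: "i \<in> reps \<Longrightarrow> r i \<in> carrier A" "i \<in> reps \<Longrightarrow> s i \<in> carrier A"
  by (simp_all add: from_rep repsD u_closed d_closed)

lemma r_s_apply: "i \<in> reps \<Longrightarrow> r i (rep_u i) = gl_u X i" "i \<in> reps \<Longrightarrow> s i (rep_d i) = gl_d X i"
  by (simp_all add: from_rep rep_u_def rep_d_def repsD u_closed d_closed)

lemma A_inv_closed: "\<lbrakk>g \<in> carrier A; x \<in> carrier X\<rbrakk> \<Longrightarrow> (inv\<^bsub>A\<^esub> g) x \<in> carrier X"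
  by (rule A_homD(1)) auto

lemmas r_hom = A_homD[OF r_s_closed(1)]
lemmas s_hom = A_homD[OF r_s_closed(2)]

lemmas A_simps = A.composition_rule A_inv_closed op_closed u_closed d_closed repsD(1)
  r_s_closed r_s_apply r_hom s_hom rep_u_d_closed translation_in_A rep_d_rep_u rep_u_rep_d op_u op_d u_op d_op u_d_op d_u_op

text \<open>Here \<open>f\<close> stands for \<open>u\<close> or \<open>d\<close>. Since
  \<open>h\<close> fixes \<open>x\<close> and commutes with \<open>f\<close> at \<open>x\<close>, it
  fixes \<open>f x = g y\<close>; conjugating by \<open>g\<close> moves this fixed point to
  \<open>y\<close>.\<close>

lemma Stab_conj:
  assumes "g \<in> carrier A" "h \<in> Stab x" "x \<in> carrier X" "y \<in> carrier X"
    and f: "g y = f x" "f x \<in> carrier X" "h (f x) = f (h x)"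
  shows "inv\<^bsub>A\<^esub> g \<otimes>\<^bsub>A\<^esub> h \<otimes>\<^bsub>A\<^esub> g \<in> Stab y"
  using assms A_homD(1)[of g] A_homD(1)[of h] A_inv_eqI[of g y]
  by (simp add: stabilizer_def A.composition_rule)

lemma gl_coset_data_reps: "gl_coset_data A reps Stab translation r s rep_u"
proof (intro gl_coset_data.intro gl_coset_data_axioms.intro A.group_axioms, goal_cases)
  case (5 i)
  show ?case
  proof
    fix h assume "h \<in> Stab i"
    then have h: "h \<in> carrier A" "h i = i" by (auto simp: stabilizer_def)
    \<comment> \<open>At \<open>x\<close> both sides give \<open>h x \<rhd> i\<close>, because
      \<open>h i = i\<close>.\<close>
    then have "h \<otimes>\<^bsub>A\<^esub> translation i = translation i \<otimes>\<^bsub>A\<^esub> h"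
      using 5 by (intro A_eqI) (auto simp: A_simps A_homD[OF h(1)])
    then show "h \<in> centraliser A (translation i)"
      using h by (simp add: centraliser_def)
  qed
next
  case (7 i h)
  then show ?case
    by (intro Stab_conj[where f = "gl_u X" and x = i])
      (auto simp: A_simps stabilizer_def A_homD(3)[of h])
next
  case (8 i h)
  then show ?case
    unfolding inv_into_rep_u[OF 8(1)]
    by (intro Stab_conj[where f = "gl_d X" and x = i])
      (auto simp: A_simps stabilizer_def A_homD(4)[of h])
next
  case (9 i)
  \<comment> \<open>As \<open>rep_d (rep_u i) = i\<close>, the product sends \<open>i\<close> first
    to \<open>d (rep_u i)\<close>, then by \<open>r i\<close> to \<open>d (u i)\<close>, and the
    translation returns it to \<open>i\<close> by \<open>d_u_op\<close>.\<close>
  have "s (rep_u i) i = gl_d X (rep_u i)"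
    using 9 r_s_apply(2)[of "rep_u i"] by (simp add: A_simps)
  then show ?case
    using 9 by (simp add: stabilizer_def A_simps)
next
  case (10 i)
  have "r (rep_d i) i = gl_u X (rep_d i)"
    using 10 r_s_apply(1)[of "rep_d i"] by (simp add: A_simps)
  then show ?case
    using 10 by (simp add: stabilizer_def A_simps inv_into_rep_u)
next
  case (11 i)
  \<comment> \<open>At \<open>x\<close> both sides give \<open>r i x \<rhd> i\<close>, since
    \<open>r i\<close> sends \<open>rep_u i\<close> to \<open>u i\<close>, and translating by
    \<open>u i\<close> is translating by \<open>i\<close>.\<close>
  then show ?case by (intro A_eqI) (auto simp: A_simps)
next
  case (12 i)
  then show ?case by (intro A_eqI) (auto simp: A_simps inv_into_rep_u)
qed (auto simp: A_simps A.stabilizer_subgroup bij_rep_u)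

sublocale reps: gl_coset_data A reps Stab translation r s rep_u
  by (rule gl_coset_data_reps)

section \<open>The isomorphism\<close>

definition to_coset :: "'a \<Rightarrow> 'a \<times> ('a \<Rightarrow> 'a) set" where
  "to_coset x = (orbit_rep x, from_rep x <#\<^bsub>A\<^esub> Stab (orbit_rep x))"

text \<open>Any \<open>g\<close> taking \<open>i\<close> to the given point may replace the chosen
  \<open>from_rep\<close>: the two agree at \<open>i\<close>, so they lie in the same coset of the
  stabiliser.\<close>

lemma to_coset_A:
  assumes "i \<in> reps" "g \<in> carrier A"
  shows "to_coset (g i) = (i, g <#\<^bsub>A\<^esub> Stab i)"
  using assms from_rep[of "g i"] A_homD(1)[of g i] orbit_rep_A[of g i]
  by (simp add: to_coset_def repsD l_coset_stabilizer)

lemma obtain_rep: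
  assumes "x \<in> carrier X"
  obtains i g where "i \<in> reps" "g \<in> carrier A" "x = g i"
  using from_rep[OF assms] assms by (metis imageI reps_def)

lemma to_coset_iso:
  "to_coset \<in> gl_iso X (coset_gl_rack A reps Stab translation r s rep_u)" (is "_ \<in> gl_iso X ?Y")
proof -
  have carrier_Y: "carrier ?Y = (SIGMA i:reps. lcosets\<^bsub>A\<^esub> (Stab i))"
    by (simp add: coset_gl_rack_def)
  have bij: "bij_betw to_coset (carrier X) (carrier ?Y)"
    unfolding bij_betw_def
  proof (intro conjI inj_onI equalityI subsetI)
    fix x y assume x: "x \<in> carrier X" and y: "y \<in> carrier X" and eq: "to_coset x = to_coset y"
    obtain i g j h where "i \<in> reps" "g \<in> carrier A" "x = g i" "j \<in> reps" "h \<in> carrier A" "y = h j"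
      using x y by (metis obtain_rep)
    with eq show "x = y" by (auto simp: to_coset_A l_coset_stabilizer repsD)
  next
    fix p assume "p \<in> to_coset ` carrier X"
    then obtain i g where "i \<in> reps" "g \<in> carrier A" "p = to_coset (g i)"
      by (metis imageE obtain_rep)
    then show "p \<in> carrier ?Y" by (auto simp: carrier_Y to_coset_A LCOSETS_def)
  next
    fix p assume "p \<in> carrier ?Y"
    then obtain i g where "i \<in> reps" "g \<in> carrier A" "p = to_coset (g i)"
      by (auto simp: carrier_Y to_coset_A LCOSETS_def)
    then show "p \<in> to_coset ` carrier X" using A_homD(1)[of g i] repsD(1) by blast
  qed
  have op: "to_coset (x \<rhd> y) = to_coset x \<rhd>\<^bsub>?Y\<^esub> to_coset y" if xy: "x \<in> carrier X" "y \<in> carrier X" for x y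
  proof -
    obtain i g j h where gh: "i \<in> reps" "g \<in> carrier A" "x = g i" "j \<in> reps" "h \<in> carrier A" "y = h j"
      using xy by (metis obtain_rep)
    \<comment> \<open>Translation by \<open>h j\<close> is the conjugate by \<open>h\<close> of
      translation by \<open>j\<close>, because \<open>h\<close> preserves the rack
      operation.\<close>
    have "x \<rhd> y = (h \<otimes>\<^bsub>A\<^esub> translation j \<otimes>\<^bsub>A\<^esub> inv\<^bsub>A\<^esub> h \<otimes>\<^bsub>A\<^esub> g) i"
      using gh A_homD(1)[of g i] A_homD(1)[of h j]
      by (simp add: A_simps A_homD(2)[of h] A_inv(2)[of h])
    then show ?thesis
      using gh by (simp add: to_coset_A reps.coset_gl_rack_op translation_in_A repsD)
  qed
  have u: "to_coset (gl_u X x) = gl_u ?Y (to_coset x)" if x: "x \<in> carrier X" for x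
  proof -
    obtain i g where g: "i \<in> reps" "g \<in> carrier A" "x = g i" using x by (metis obtain_rep)
    then have "gl_u X x = (g \<otimes>\<^bsub>A\<^esub> r i) (rep_u i)"
      by (simp add: A_simps A_homD(3)[of g])
    then show ?thesis
      using g by (simp add: to_coset_A reps.coset_gl_rack_u r_s_closed rep_u_d_closed)
  qed
  have d: "to_coset (gl_d X x) = gl_d ?Y (to_coset x)" if x: "x \<in> carrier X" for x
  proof -
    obtain i g where g: "i \<in> reps" "g \<in> carrier A" "x = g i" using x by (metis obtain_rep)
    then have "gl_d X x = (g \<otimes>\<^bsub>A\<^esub> s i) (rep_d i)"
      by (simp add: A_simps A_homD(4)[of g])
    then show ?thesis
      using g by (simp add: to_coset_A reps.coset_gl_rack_d r_s_closed rep_u_d_closed inv_into_rep_u)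
  qed
  show ?thesis
    using bij op u d by (auto simp: gl_iso_def gl_hom_def bij_betw_def)
qed

end

theorem theorem5p2:
  fixes X :: "('a, 'm) gl_rack_scheme"
  assumes "gl_rack X"
  shows "\<exists>(G :: ('a \<Rightarrow> 'a) monoid) (I :: 'a set) H z r s \<tau>.
    gl_coset_data G I H z r s \<tau> \<and>
    gl_rack (coset_gl_rack G I H z r s \<tau>) \<and>
    gl_isomorphic X (coset_gl_rack G I H z r s \<tau>)"
proof -
  interpret gl_rack X by fact
  show ?thesis
    using gl_coset_data_reps to_coset_iso gl_rack_iso[OF assms to_coset_iso]
    unfolding gl_isomorphic_def by blast
qed

end
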